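(* Let $n, p, q$ be integers with $n \ge 5$ and $1 \le p < q < \frac{n}{2}$. The graph $\mathrm{Circ}(n, \{p, q\})$ is a nut graph if and only if all of the following conditions hold: (i) $n$ is even; (ii) $p$ and $q$ are of different parities; (iii) $\gcd(n, p+q) = \gcd(n, q-p) = 1$.
   Context: For an integer $n \ge 1$ and a set $S$ of integers $j$ with $1 \le j \le \frac{n}{2}$, $\mathrm{Circ}(n, S)$ denotes the circulant graph with vertex set $\{0, 1, \ldots, n-1\}$ in which two distinct vertices $i, k$ are adjacent if and only if $i - k \equiv s$ or $i - k \equiv -s \pmod n$ for some $s \in S$. The null space and nullity of a graph are those of its (real) adjacency matrix. A full vector is a vector without zero entries. A nut graph is a graph whose nullity is one and whose null space is spanned by a full vector. *)

theory Defs
  imports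
    "HOL-Number_Theory.Cong"
    "Graph_Theory.Pair_Digraph"
    "Jordan_Normal_Form.Matrix_Kernel"
begin

text \<open>
  Simple graphs are the symmetric loop-free pair digraphs (locale \<^locale>\<open>pair_graph\<close>); an edge
  is represented by its two arcs.
\<close>

definition Circ :: "nat \<Rightarrow> nat set \<Rightarrow> nat pair_pre_digraph" where
  "Circ n S = \<lparr>pverts = {0..<n},
     parcs = {(i, k). i < n \<and> k < n \<and> i \<noteq> k \<and>
       (\<exists>s\<in>S. [int i - int k = int s] (mod int n) \<or> [int i - int k = - int s] (mod int n))}\<rparr>"

lemma pair_graph_Circ: "pair_graph (Circ n S)"
proof
  show "finite (parcs (Circ n S))"
    by (rule finite_subset[of _ "{0..<n} \<times> {0..<n}"]) (auto simp: Circ_def)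
  have "(k, i) \<in> parcs (Circ n S)" if "(i, k) \<in> parcs (Circ n S)" for i k
  proof -
    from that obtain s where s: "s \<in> S" "i < n" "k < n" "i \<noteq> k"
      "[int i - int k = int s] (mod int n) \<or> [int i - int k = - int s] (mod int n)"
      by (auto simp: Circ_def)
    from s(5) have "[int k - int i = int s] (mod int n) \<or> [int k - int i = - int s] (mod int n)"
      using cong_minus_minus_iff[of "int i - int k" "int s" "int n"]
        cong_minus_minus_iff[of "int i - int k" "- int s" "int n"] by auto
    with s show ?thesis by (auto simp: Circ_def)
  qed
  then show "symmetric (with_proj (Circ n S))"
    by (auto simp: symmetric_def sym_def)
qed (auto simp: Circ_def)

text \<open>
  The vertices are enumerated in increasing order; for vertex set \<open>{0..<n}\<close>, row and column \<open>i\<close>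
  belong to vertex \<open>i\<close>.
\<close>

definition adjacency_matrix :: "'a::linorder pair_pre_digraph \<Rightarrow> real mat" where
  "adjacency_matrix G =
     (let vs = sorted_list_of_set (pverts G); n = length vs
      in mat n n (\<lambda>(i, j). if (vs ! i, vs ! j) \<in> parcs G then 1 else 0))"

lemma adjacency_matrix_Circ:
  "adjacency_matrix (Circ n S) = mat n n (\<lambda>(i, j). if (i, j) \<in> parcs (Circ n S) then 1 else 0)"
  by (auto simp: adjacency_matrix_def Circ_def Let_def intro!: eq_matI)

definition null_space :: "'a::linorder pair_pre_digraph \<Rightarrow> real vec set" where
  "null_space G = mat_kernel (adjacency_matrix G)"

definition nullity :: "'a::linorder pair_pre_digraph \<Rightarrow> nat" where
  "nullity G = kernel_dim (adjacency_matrix G)"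

definition full_vec :: "'a::zero vec \<Rightarrow> bool" where
  "full_vec v \<longleftrightarrow> (\<forall>i<dim_vec v. v $ i \<noteq> 0)"

definition nut_graph :: "'a::linorder pair_pre_digraph \<Rightarrow> bool" where
  "nut_graph G \<longleftrightarrow> pair_graph G \<and> nullity G = 1 \<and>
     (\<exists>v\<in>carrier_vec (card (pverts G)). full_vec v \<and>
        null_space G =
          LinearCombinations.module.span class_ring
            (module_vec TYPE(real) (card (pverts G))) {v})"

end

theory Submission
  imports Defs "HOL-Library.Periodic_Fun"
begin

text \<open>
  Write \<open>T\<close> for the cyclic shift. The adjacency operator of \<open>Circ n {p, q}\<close> is
  \<open>T\<^sup>p + T\<^sup>-\<^sup>p + T\<^sup>q + T\<^sup>-\<^sup>q = T\<^sup>-\<^sup>q (T\<^sup>p\<^sup>+\<^sup>q + 1) (T\<^sup>q\<^sup>-\<^sup>p + 1)\<close>.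
  If the null space is spanned by one vector \<open>v\<close>, then \<open>v\<close> is an eigenvector of \<open>T\<close>; its eigenvalue
  is a real root of unity and not \<open>1\<close>, so it is \<open>-1\<close>, which forces \<open>n\<close> to be even and the parities
  of \<open>p\<close> and \<open>q\<close> to differ. If moreover \<open>d\<close> divides \<open>n\<close> and \<open>q + p\<close>, or \<open>n\<close> and \<open>q - p\<close>, then the
  alternating vector restricted to the multiples of \<open>d\<close> is a null vector, and \<open>v\<close> is full only if
  \<open>d = 1\<close>. Conversely, under the three conditions each factor alone has only the multiples of the
  alternating vector in its kernel, and an alternating vector is not in the image of a factor unless
  it is zero.
\<close>

section \<open>Vectors as periodic functions on the integers\<close>

text \<open>Reading a vector at every integer turns index arithmetic modulo the dimension into plain
  addition, so shifts never wrap around.\<close>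

definition cyc :: "'a vec \<Rightarrow> int \<Rightarrow> 'a" where
  "cyc v i = v $ nat (i mod int (dim_vec v))"

lemma cyc_add_dim: "v \<in> carrier_vec n \<Longrightarrow> cyc v (i + int n) = cyc v i"
  by (auto simp: cyc_def)

lemma cyc_of_nat: "k < dim_vec v \<Longrightarrow> cyc v (int k) = v $ k"
  by (simp add: cyc_def)

lemma periodic_mod:
  fixes f :: "int \<Rightarrow> 'b"
  assumes "\<And>i. f (i + m) = f i"
  shows "f (i mod m) = f i"
proof -
  interpret periodic_fun_simple f m
    by standard (rule assms)
  show ?thesis
    using plus_of_int[of "i mod m" "i div m"] by simp
qed

lemma cyc_vec:
  assumes "\<And>i. f (i + int n) = f i" and "n > 0"
  shows "cyc (vec n (\<lambda>k. f (int k))) i = f i"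
proof -
  have "nat (i mod int n) < n"
    using \<open>n > 0\<close> by (simp add: nat_less_iff)
  then show ?thesis
    using \<open>n > 0\<close> periodic_mod[of f "int n" i, OF assms(1)] by (simp add: cyc_def)
qed

section \<open>The adjacency operator as a sum of shifts\<close>

lemma adjacency_matrix_Circ_carrier: "adjacency_matrix (Circ n S) \<in> carrier_mat n n"
  by (simp add: adjacency_matrix_Circ)

text \<open>The bound \<open>2 * s < n\<close> makes the signed offsets \<open>s\<close> and
  \<open>- s\<close> nonzero and pairwise incongruent modulo \<open>n\<close>, so every neighbour of
  \<open>i\<close> is counted exactly once.\<close>

lemma adjacency_matrix_Circ_mult_vec:
  assumes S: "\<And>s. s \<in> S \<Longrightarrow> 0 < s \<and> 2 * s < n"
    and v: "v \<in> carrier_vec n" and i: "i < n"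
  shows "(adjacency_matrix (Circ n S) *\<^sub>v v) $ i =
    (\<Sum>s\<in>S. cyc v (int i + int s) + cyc v (int i - int s))"
proof -
  \<comment> \<open>\<open>D\<close> collects the signed offsets; \<open>g t\<close> is the vertex
    reached from \<open>i\<close> by the offset \<open>t\<close>.\<close>
  define D where "D = int ` S \<union> (\<lambda>s. - int s) ` S"
  define g where "g t = nat ((int i + t) mod int n)" for t
  have "n > 0"
    using i by simp
  have "finite S"
    by (rule finite_subset[of _ "{..n}"]) (use S in fastforce)+
  have D: "t \<noteq> 0" "2 * \<bar>t\<bar> < int n" if "t \<in> D" for t
    using that S unfolding D_def by fastforce+
  have int_g: "int (g t) = (int i + t) mod int n" for t
    using \<open>n > 0\<close> by (simp add: g_def)
  have g_less: "g t < n" for t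
    using \<open>n > 0\<close> by (simp add: g_def nat_less_iff)
  have cong_g: "[int i - int (g t) = - t] (mod int n)" for t
  proof -
    have "(int i - (int i + t) mod int n) mod int n = (int i - (int i + t)) mod int n"
      by (rule mod_diff_right_eq)
    then show ?thesis
      by (simp add: cong_def int_g)
  qed
  have g_eq: "k = g t" if "[int i - int k = - t] (mod int n)" "k < n" for k t
  proof -
    have "[int k = int i + t] (mod int n)"
      using cong_diff[OF cong_refl[of "int i"] that(1)] by simp
    then show ?thesis
      using \<open>k < n\<close> by (simp add: cong_def g_def flip: of_nat_mod)
  qed
  have small: "t = 0" if "int n dvd t" "\<bar>t\<bar> < int n" for t :: int
    using that dvd_imp_le_int[of t "int n"] by fastforce
  have inj: "inj_on g D"
  proof
    fix t u assume tu: "t \<in> D" "u \<in> D" "g t = g u"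
    then have "[- t = - u] (mod int n)"
      using cong_g[of t] cong_g[of u] cong_trans cong_sym by metis
    then have "int n dvd t - u"
      by (simp add: cong_iff_dvd_diff dvd_diff_commute)
    moreover have "\<bar>t - u\<bar> < int n"
      using D[of t] D[of u] tu by linarith
    ultimately show "t = u"
      using small[of "t - u"] by simp
  qed
  have nbrs: "{k \<in> {0..<n}. (i, k) \<in> parcs (Circ n S)} = g ` D"
  proof (intro subset_antisym subsetI)
    fix k assume "k \<in> {k \<in> {0..<n}. (i, k) \<in> parcs (Circ n S)}"
    then obtain s where "s \<in> S" "k < n"
      \<comment> \<open>The double negation lets \<open>g_eq\<close> apply with the offset
        \<open>- int s\<close>.\<close>
      "[int i - int k = - (- int s)] (mod int n) \<or> [int i - int k = - int s] (mod int n)"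
      by (auto simp: Circ_def)
    then have "k = g (- int s) \<or> k = g (int s)"
      using g_eq by blast
    then show "k \<in> g ` D"
      using \<open>s \<in> S\<close> by (auto simp: D_def)
  next
    fix k assume "k \<in> g ` D"
    then obtain t where t: "t \<in> D" "k = g t"
      by blast
    have "i \<noteq> k"
    proof
      assume "i = k"
      then have "int n dvd t"
        using cong_g[of t] t(2) by (simp add: cong_iff_dvd_diff)
      then show False
        using small[of t] D[OF t(1)] by linarith
    qed
    then show "k \<in> {k \<in> {0..<n}. (i, k) \<in> parcs (Circ n S)}"
      using t g_less[of t] cong_g[of t] i by (auto simp: D_def Circ_def)
  qed
  have "(adjacency_matrix (Circ n S) *\<^sub>v v) $ i =
      (\<Sum>k = 0..<n. if (i, k) \<in> parcs (Circ n S) then v $ k else 0)"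
    using v i by (auto simp: adjacency_matrix_Circ scalar_prod_def intro!: sum.cong)
  also have "\<dots> = (\<Sum>k\<in>g ` D. v $ k)"
    unfolding nbrs[symmetric] by (rule sum.inter_filter[symmetric]) simp
  also have "\<dots> = (\<Sum>t\<in>D. cyc v (int i + t))"
    using v by (simp add: sum.reindex[OF inj]) (simp add: g_def cyc_def)
  also have "\<dots> = (\<Sum>t\<in>int ` S. cyc v (int i + t)) + (\<Sum>t\<in>(\<lambda>s. - int s) ` S. cyc v (int i + t))"
    unfolding D_def using \<open>finite S\<close> S by (intro sum.union_disjoint) fastforce+
  also have "\<dots> = (\<Sum>s\<in>S. cyc v (int i + int s) + cyc v (int i - int s))"
    by (simp add: sum.reindex inj_on_def sum.distrib)
  finally show ?thesis .
qed

text \<open>The row sums are periodic in \<open>i\<close>, so their vanishing at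
  \<open>0, ..., n - 1\<close> extends to all integers.\<close>

lemma null_space_Circ_iff:
  assumes S: "\<And>s. s \<in> S \<Longrightarrow> 0 < s \<and> 2 * s < n"
    and "n > 0" and v: "v \<in> carrier_vec n"
  shows "v \<in> null_space (Circ n S) \<longleftrightarrow> (\<forall>i. (\<Sum>s\<in>S. cyc v (i + int s) + cyc v (i - int s)) = 0)"
proof -
  let ?h = "\<lambda>i. \<Sum>s\<in>S. cyc v (i + int s) + cyc v (i - int s)"
  have per: "?h (i + int n) = ?h i" for i
    using cyc_add_dim[OF v, of "i + int s" for s] cyc_add_dim[OF v, of "i - int s" for s]
    by (simp add: algebra_simps)
  have "v \<in> null_space (Circ n S) \<longleftrightarrow> (\<forall>k<n. (adjacency_matrix (Circ n S) *\<^sub>v v) $ k = 0)"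
    using v by (auto simp: null_space_def mat_kernel_def adjacency_matrix_Circ vec_eq_iff)
  also have "\<dots> \<longleftrightarrow> (\<forall>k<n. ?h (int k) = 0)"
    using adjacency_matrix_Circ_mult_vec[OF S v] by simp
  also have "\<dots> \<longleftrightarrow> (\<forall>i. ?h i = 0)"
  proof
    assume h: "\<forall>k<n. ?h (int k) = 0"
    show "\<forall>i. ?h i = 0"
    proof
      fix i
      have "?h i = ?h (int (nat (i mod int n)))"
        using periodic_mod[of ?h "int n" i, OF per] \<open>n > 0\<close> by simp
      also have "\<dots> = 0"
        using h \<open>n > 0\<close> by (metis Euclidean_Rings.pos_mod_bound Euclidean_Rings.pos_mod_sign
            nat_less_iff of_nat_0_less_iff)
      finally show "?h i = 0" .
    qed
  qed simp
  finally show ?thesis .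
qed

section \<open>Spans and kernels generated by one vector\<close>

lemma span_single:
  fixes v :: "'a::field vec"
  assumes v: "v \<in> carrier_vec n"
  shows "LinearCombinations.module.span class_ring (module_vec TYPE('a) n) {v} = range (\<lambda>c. c \<cdot>\<^sub>v v)"
proof -
  interpret vec_space "TYPE('a)" n .
  show ?thesis
  proof (intro subset_antisym subsetI)
    fix w assume "w \<in> span {v}"
    then obtain a A where "w = lincomb a A" "A \<subseteq> {v}"
      using in_spanE by blast
    then have "w = 0\<^sub>v n \<or> w = a v \<cdot>\<^sub>v v"
      using v by (auto simp: lincomb_def subset_singleton_iff)
    moreover have "0\<^sub>v n = 0 \<cdot>\<^sub>v v"
      using v by auto
    ultimately show "w \<in> range (\<lambda>c. c \<cdot>\<^sub>v v)"
      by auto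
  next
    fix w assume "w \<in> range (\<lambda>c. c \<cdot>\<^sub>v v)"
    then obtain c where "w = c \<cdot>\<^sub>v v"
      by blast
    then show "w \<in> span {v}"
      using v in_own_span[of "{v}"] by (auto intro: smult_in_span)
  qed
qed

lemma kernel_dim_single:
  fixes A :: "'a::field mat"
  assumes A: "A \<in> carrier_mat nr nc" and v: "v \<in> carrier_vec nc" "v \<noteq> 0\<^sub>v nc"
    and ker: "mat_kernel A = range (\<lambda>c. c \<cdot>\<^sub>v v)"
  shows "kernel_dim A = 1"
proof -
  interpret kernel nr nc A
    by standard (rule A)
  have "v \<in> mat_kernel A"
    unfolding ker by (rule range_eqI[of _ _ 1]) simp
  then have "span {v} = mat_kernel A"
    using span_same[of "{v}"] span_single[OF v(1)] ker by simp
  then have "dim = 1"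
    using \<open>v \<in> mat_kernel A\<close> v(2) by (intro Ker.dim1I[of v]) auto
  then show ?thesis
    by simp
qed

lemma nut_graph_Circ_iff:
  "nut_graph (Circ n S) \<longleftrightarrow> nullity (Circ n S) = 1 \<and>
    (\<exists>v\<in>carrier_vec n. full_vec v \<and> null_space (Circ n S) = range (\<lambda>c. c \<cdot>\<^sub>v v))"
proof -
  have "card (pverts (Circ n S)) = n"
    by (simp add: Circ_def)
  then show ?thesis
    using span_single[where 'a = real and n = n]
    by (auto simp: nut_graph_def pair_graph_Circ)
qed

section \<open>Alternating and antiperiodic functions\<close>

definition alt :: "int \<Rightarrow> real" where
  "alt i = (if even i then 1 else - 1)"

lemma alt_mult_self: "alt i * alt i = 1"
  by (simp add: alt_def)

text \<open>By Bezout, every integer is reached from \<open>0\<close> by steps of length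
  \<open>m\<close> and \<open>c\<close>.\<close>

lemma periodic_coprime_const:
  fixes f :: "int \<Rightarrow> 'b"
  assumes "\<And>i. f (i + m) = f i" and "\<And>i. f (i + c) = f i" and "coprime m c"
  shows "f i = f 0"
proof -
  interpret M: periodic_fun_simple f m
    by standard (rule assms)
  interpret C: periodic_fun_simple f c
    by standard (rule assms)
  obtain u w where uw: "u * m + w * c = 1"
    using bezout_int[of m c] \<open>coprime m c\<close> by auto
  have "i = 0 + of_int (i * u) * m + of_int (i * w) * c"
    using arg_cong[OF uw, of "\<lambda>x. i * x"] by (simp add: algebra_simps)
  then show ?thesis
    by (metis M.plus_of_int C.plus_of_int)
qed

text \<open>Multiplication by \<open>alt\<close> turns the odd antiperiod \<open>c\<close> into a
  period and keeps the even period \<open>n\<close>; two coprime periods force a constant.\<close>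

lemma antiperiodic_coprime_alt:
  fixes x :: "int \<Rightarrow> real"
  assumes per: "\<And>i. x (i + int n) = x i" and "even n"
    and anti: "\<And>i. x (i + c) = - x i" and "odd c" and "coprime (int n) c"
  shows "x i = alt i * x 0"
proof -
  have "alt i * x i = alt 0 * x 0"
  proof (rule periodic_coprime_const[of "\<lambda>i. alt i * x i" "int n" c])
    show "alt (i + int n) * x (i + int n) = alt i * x i" for i
      using \<open>even n\<close> per by (simp add: alt_def)
    show "alt (i + c) * x (i + c) = alt i * x i" for i
      using \<open>odd c\<close> anti by (simp add: alt_def)
  qed fact
  then show ?thesis
    using alt_mult_self[of i] by (auto simp: alt_def split: if_splits)
qed

text \<open>After multiplication by \<open>alt\<close>, each step of length \<open>b\<close>
  subtracts \<open>K\<close>. Then \<open>n\<close> steps subtract \<open>n * K\<close>, yet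
  together they move by a multiple of the period \<open>n\<close>.\<close>

lemma add_shift_eq_alt_imp_zero:
  fixes x :: "int \<Rightarrow> real"
  assumes per: "\<And>i. x (i + int n) = x i" and "even n" and "n > 0"
    and eq: "\<And>i. x (i + b) + x i = alt i * K" and "odd b"
  shows "K = 0"
proof -
  define z where "z i = alt i * x i" for i
  have step: "z (i + b) = z i - K" for i
    using eq[of i] \<open>odd b\<close> by (auto simp: z_def alt_def split: if_splits)
  have "z (int k * b) = z 0 - real k * K" for k
  proof (induction k)
    case (Suc k)
    then show ?case
      using step[of "int k * b"] by (simp add: algebra_simps)
  qed simp
  then have "z (int n * b) = z 0 - real n * K" .
  moreover interpret periodic_fun_simple z "int n"
    by standard (use per \<open>even n\<close> in \<open>simp add: z_def alt_def\<close>)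
  have "z (int n * b) = z 0"
    using plus_of_int[of 0 b] by (simp add: mult.commute)
  ultimately show ?thesis
    using \<open>n > 0\<close> by simp
qed

section \<open>Circulant graphs with two generators\<close>

context
  fixes n p q :: nat
  assumes n: "n \<ge> 5" and p: "1 \<le> p" and pq: "p < q" and qn: "2 * q < n"
begin

text \<open>Translating by \<open>q\<close> makes the offsets \<open>q, p, -p, -q\<close> into
  \<open>2q, q + p, q - p, 0\<close>; this exposes the product of the two factors.\<close>

lemma null_space_Circ_pair_iff:
  assumes v: "v \<in> carrier_vec n"
  shows "v \<in> null_space (Circ n {p, q}) \<longleftrightarrow>
    (\<forall>i. (cyc v (i + int (p + q) + int (q - p)) + cyc v (i + int (p + q))) +
      (cyc v (i + int (q - p)) + cyc v i) = 0)" (is "_ \<longleftrightarrow> (\<forall>i. ?h i = 0)")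
proof -
  have h: "(\<Sum>s\<in>{p, q}. cyc v (i + int s) + cyc v (i - int s)) = ?h (i - int q)" for i
    using pq by (simp add: of_nat_diff algebra_simps)
  have "0 < s \<and> 2 * s < n" if "s \<in> {p, q}" for s
    using that p pq qn by auto
  then have "v \<in> null_space (Circ n {p, q}) \<longleftrightarrow> (\<forall>i. ?h (i - int q) = 0)"
    using null_space_Circ_iff[of "{p, q}" n v] v n unfolding h by simp
  also have "\<dots> \<longleftrightarrow> (\<forall>i. ?h i = 0)"
    by (metis add_diff_cancel_right')
  finally show ?thesis .
qed

text \<open>The two factors commute, so being annihilated by either one suffices.\<close>

lemma antiperiodic_in_null_space:
  assumes per: "\<And>i. f (i + int n) = f i" and "c = p + q \<or> c = q - p"
    and anti: "\<And>i. f (i + int c) = - f i"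
  shows "vec n (\<lambda>k. f (int k)) \<in> null_space (Circ n {p, q})"
proof -
  have "cyc (vec n (\<lambda>k. f (int k))) = f"
    using cyc_vec[of f n] per n by auto
  moreover have "(f (i + int (p + q) + int (q - p)) + f (i + int (p + q))) +
      (f (i + int (q - p)) + f i) = 0" for i
    using assms(2)
  proof
    assume "c = p + q"
    then show ?thesis
      using anti[of i] anti[of "i + int (q - p)"] by (simp add: algebra_simps)
  next
    assume "c = q - p"
    then show ?thesis
      using anti[of i] anti[of "i + int (p + q)"] by (simp add: algebra_simps)
  qed
  ultimately show ?thesis
    by (simp add: null_space_Circ_pair_iff)
qed

lemma nut_graph_Circ_pair_imp:
  assumes "nut_graph (Circ n {p, q})"
  shows "even n \<and> even p \<noteq> even q \<and> gcd n (p + q) = 1 \<and> gcd n (q - p) = 1"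
proof -
  obtain v where v: "v \<in> carrier_vec n" and full: "full_vec v"
    and ns: "null_space (Circ n {p, q}) = range (\<lambda>c. c \<cdot>\<^sub>v v)"
    using assms by (auto simp: nut_graph_Circ_iff)
  define x where "x = cyc v"
  have per: "x (i + int n) = x i" for i
    using cyc_add_dim[OF v] by (simp add: x_def)
  have x_nat: "x (int k) = v $ k" if "k < n" for k
    using that v by (simp add: x_def cyc_of_nat)
  have nz: "x 0 \<noteq> 0"
    using x_nat[of 0] full v n by (auto simp: full_vec_def)
  have "1 \<cdot>\<^sub>v v \<in> null_space (Circ n {p, q})"
    unfolding ns by blast
  then have xeq: "(x (i + int (p + q) + int (q - p)) + x (i + int (p + q))) +
      (x (i + int (q - p)) + x i) = 0" for i
    using null_space_Circ_pair_iff[OF v] by (simp add: x_def)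
  \<comment> \<open>The rotation of \<open>v\<close> by one place is again a null vector, hence a
    multiple of \<open>v\<close>.\<close>
  let ?u = "vec n (\<lambda>k. x (int k + 1))"
  have shift: "cyc ?u i = x (i + 1)" for i
    using cyc_vec[of "\<lambda>i. x (i + 1)" n i] per[of "j + 1" for j] n by (simp add: algebra_simps)
  have "?u \<in> null_space (Circ n {p, q})"
    unfolding null_space_Circ_pair_iff[OF vec_carrier] shift
  proof
    fix i
    show "x (i + int (p + q) + int (q - p) + 1) + x (i + int (p + q) + 1) +
        (x (i + int (q - p) + 1) + x (i + 1)) = 0"
      using xeq[of "i + 1"] by (simp only: ac_simps)
  qed
  then obtain c where "?u = c \<cdot>\<^sub>v v"
    unfolding ns by blast
  then have c: "x (int k + 1) = c * x (int k)" if "k < n" for k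
    using that v x_nat by (auto simp: vec_eq_iff)
  have c': "x (i + 1) = c * x i" for i
  proof -
    interpret X: periodic_fun_simple x "int n"
      by standard (rule per)
    let ?k = "nat (i mod int n)"
    have k: "int ?k = i mod int n" "?k < n"
      using n by (simp_all add: nat_less_iff)
    have "x (i + 1) = x (int ?k + 1)"
      using X.plus_of_int[of "i mod int n + 1" "i div int n"] k(1) by (simp add: algebra_simps)
    also have "\<dots> = c * x i"
      using c[OF k(2)] periodic_mod[of x "int n" i, OF per] k(1) by simp
    finally show ?thesis .
  qed
  have pow: "x (int k) = c ^ k * x 0" for k
  proof (induction k)
    case (Suc k)
    then show ?case
      using c'[of "int k"] by (simp add: add.commute)
  qed simp
  have "c ^ n = 1"
    using pow[of n] per[of 0] nz by simp
  then have "\<bar>c\<bar> = 1"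
    using power_eq_1_iff[of c n] n by auto
  have sum: "c ^ (p + q + (q - p)) + c ^ (p + q) + c ^ (q - p) + 1 = 0"
  proof -
    have "(c ^ (p + q + (q - p)) + c ^ (p + q) + c ^ (q - p) + 1) * x 0 = 0"
      using xeq[of 0] pow[of "p + q + (q - p)"] pow[of "p + q"] pow[of "q - p"]
      by (simp add: algebra_simps del: of_nat_diff)
    then show ?thesis
      using nz by simp
  qed
  \<comment> \<open>For \<open>c = 1\<close> the sum would be 4.\<close>
  have "c = - 1"
    using \<open>\<bar>c\<bar> = 1\<close> sum by (auto simp: abs_if split: if_splits)
  have "even n"
    using \<open>c ^ n = 1\<close> \<open>c = - 1\<close> by (cases "even n") auto
  \<comment> \<open>At \<open>c = - 1\<close> a factor \<open>c ^ (p + q) + 1\<close> or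
    \<open>c ^ (q - p) + 1\<close> vanishes, and the two exponents have equal parity.\<close>
  have par: "odd (p + q)" "odd (q - p)"
    using sum pq unfolding \<open>c = - 1\<close> by (cases "even p"; cases "even q"; simp)+
  have gcd: "gcd n a = 1" if a: "a = p + q \<or> a = q - p" for a
  proof -
    define d where "d = gcd n a"
    have "odd a"
      using a par by auto
    define f where "f i = (if int d dvd i then alt i else 0)" for i
    have dn: "int d dvd int n" and da: "int d dvd int a"
      by (simp_all add: d_def)
    have "vec n (\<lambda>k. f (int k)) \<in> null_space (Circ n {p, q})"
    proof (rule antiperiodic_in_null_space[OF _ a])
      show "f (i + int n) = f i" for i
        using dn \<open>even n\<close> by (simp add: f_def alt_def dvd_add_left_iff)
      show "f (i + int a) = - f i" for i
        using da \<open>odd a\<close> by (simp add: f_def alt_def dvd_add_left_iff)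
    qed
    then obtain m where "vec n (\<lambda>k. f (int k)) = m \<cdot>\<^sub>v v"
      unfolding ns by blast
    then have m: "f (int k) = m * v $ k" if "k < n" for k
      using that v by (auto simp: vec_eq_iff)
    \<comment> \<open>Since \<open>f 0 = 1\<close>, the factor \<open>m\<close> is nonzero; fullness
      of \<open>v\<close> then gives \<open>f 1 \<noteq> 0\<close>, that is, \<open>d\<close>
      divides 1.\<close>
    have "m \<noteq> 0"
      using m[of 0] n by (auto simp: f_def alt_def)
    then have "f 1 \<noteq> 0"
      using m[of 1] n full v by (auto simp: full_vec_def)
    then show ?thesis
      by (simp add: f_def d_def split: if_splits)
  qed
  show ?thesis
    using \<open>even n\<close> par gcd by auto
qed

lemma nut_graph_Circ_pairI:
  assumes cond: "even n \<and> even p \<noteq> even q \<and> gcd n (p + q) = 1 \<and> gcd n (q - p) = 1"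
  shows "nut_graph (Circ n {p, q})"
proof -
  have "even n" and par: "even p \<noteq> even q" and gcds: "gcd n (p + q) = 1" "gcd n (q - p) = 1"
    using cond by blast+
  let ?v = "vec n (\<lambda>k. alt (int k))"
  have odd: "odd (int (p + q))" "odd (int (q - p))"
    using par pq by auto
  have cop: "coprime (int n) (int (p + q))" "coprime (int n) (int (q - p))"
    using gcds by (simp_all only: coprime_int_iff coprime_iff_gcd_eq_1[symmetric])
  have "?v \<in> null_space (Circ n {p, q})"
    by (rule antiperiodic_in_null_space[of _ "p + q"])
      (use \<open>even n\<close> odd in \<open>auto simp: alt_def\<close>)
  then have "c \<cdot>\<^sub>v ?v \<in> null_space (Circ n {p, q})" for c
    using mat_kernel_smult[OF adjacency_matrix_Circ_carrier] by (simp add: null_space_def)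
  moreover have "w \<in> range (\<lambda>c. c \<cdot>\<^sub>v ?v)" if w: "w \<in> null_space (Circ n {p, q})" for w
  proof -
    have wc: "w \<in> carrier_vec n"
      using w mat_kernel_carrier[OF adjacency_matrix_Circ_carrier] by (auto simp: null_space_def)
    define x where "x = cyc w"
    have per: "x (i + int n) = x i" for i
      using cyc_add_dim[OF wc] by (simp add: x_def)
    \<comment> \<open>One factor is peeled off at a time: \<open>y\<close> is annihilated by the
      factor of \<open>p + q\<close>, hence alternating; as an image under the factor of
      \<open>q - p\<close> it must be zero, which leaves \<open>x\<close> annihilated by that
      factor.\<close>
    define y where "y i = x (i + int (q - p)) + x i" for i
    have y_per: "y (i + int n) = y i" for i
      using per[of i] per[of "i + int (q - p)"] by (simp add: y_def algebra_simps)
    have y_anti: "y (i + int (p + q)) = - y i" for i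
      using w[unfolded null_space_Circ_pair_iff[OF wc], rule_format, of i]
      unfolding y_def x_def by linarith
    have y: "y i = alt i * y 0" for i
      by (rule antiperiodic_coprime_alt[OF y_per \<open>even n\<close> y_anti odd(1) cop(1)])
    have "y 0 = 0"
      by (rule add_shift_eq_alt_imp_zero[of x n "int (q - p)"])
        (use per \<open>even n\<close> n odd y in \<open>auto simp: y_def\<close>)
    then have "x (i + int (q - p)) = - x i" for i
      using y[of i] by (simp add: y_def)
    from antiperiodic_coprime_alt[OF per \<open>even n\<close> this odd(2) cop(2)]
    have x: "x i = alt i * x 0" for i .
    have "w = x 0 \<cdot>\<^sub>v ?v"
    proof (rule eq_vecI)
      show "w $ k = (x 0 \<cdot>\<^sub>v ?v) $ k" if "k < dim_vec (x 0 \<cdot>\<^sub>v ?v)" for k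
        using that wc cyc_of_nat[of k w] x[of "int k"] by (simp add: x_def)
    qed (use wc in simp)
    then show ?thesis
      by blast
  qed
  ultimately have ns: "null_space (Circ n {p, q}) = range (\<lambda>c. c \<cdot>\<^sub>v ?v)"
    by blast
  have full: "full_vec ?v"
    by (simp add: full_vec_def alt_def)
  have "?v \<noteq> 0\<^sub>v n"
    using n by (auto simp: vec_eq_iff alt_def intro!: exI[of _ 0])
  then have "nullity (Circ n {p, q}) = 1"
    unfolding nullity_def using ns
    by (intro kernel_dim_single[OF adjacency_matrix_Circ_carrier, of ?v]) (auto simp: null_space_def)
  then show ?thesis
    unfolding nut_graph_Circ_iff using ns full by (auto intro!: bexI[of _ ?v])
qed

end

theorem corollary7:
  fixes n p q :: nat
  assumes "n \<ge> 5" and "1 \<le> p" and "p < q" and "real q < real n / 2"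
  shows "nut_graph (Circ n {p, q}) \<longleftrightarrow>
    even n \<and> even p \<noteq> even q \<and> gcd n (p + q) = 1 \<and> gcd n (q - p) = 1"
proof -
  have "2 * q < n"
    using assms(4) by linarith
  note bounds = assms(1-3) this
  show ?thesis
    by (rule iffI[OF nut_graph_Circ_pair_imp[OF bounds] nut_graph_Circ_pairI[OF bounds]])
qed

end
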